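(* Let $a,k$ be positive integers and let $T=T\big(a,a+1,\ldots,a+k,(a+\tfrac k2)(k+1)\big)$. Set $h=(k-1)(2a+k)+2a-1$ and for $p\in\{1,\ldots,a+k\}$ let $$D_p=\begin{cases}\{ph+p(p-1)+2pi:\ i\in\{1,\ldots,k+1\}\}, & p\in\{1,\ldots,a\},\\ \{ph+p(p-1)+2pi:\ i\in\{1,\ldots,(k+1)-(p-a)\}\}, & p\in\{a+1,\ldots,a+k\},\end{cases}$$ and $D=\bigcup_{p=1}^{a+k}D_p$. If no $d\in D$ is a perfect square lying in the interval $\big[k(2a+k-1)+1,\ (a+\tfrac k2)^2(k+1)^2\big]$, then $T$ is transmission irregular.
   Context: The transmission of a vertex $v$ of a graph $G$ is ${\rm Tr}_G(v)=\sum_{u\in V(G)} d_G(u,v)$; $G$ is transmission irregular if all its vertices have pairwise different transmissions. For $t\ge3$ and positive integers $k_1,\ldots,k_t$, the starlike tree $T(k_1,\ldots,k_t)$ is the tree obtained by attaching to a single vertex $t$ pendant paths of lengths $k_1,\ldots,k_t$. Note $(a+\frac k2)(k+1)=a+(a+1)+\cdots+(a+k)$ is an integer. *)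

theory Defs
  imports
    "Graph_Theory.Pair_Digraph"
    "Graph_Theory.Digraph_Component"
    "Graph_Theory.Shortest_Path"
    "HOL-Computational_Algebra.Nth_Powers"
begin

text \<open>
  A simple graph is a \<^locale>\<open>graph\<close>, that is, a finite loop-free symmetric digraph without parallel
  arcs: each edge \<open>uv\<close> is represented by the two arcs \<open>(u, v)\<close> and \<open>(v, u)\<close>. The distance is the
  minimum of the lengths of walks (all arcs have weight 1); it is extended-real valued, being
  \<open>\<infinity>\<close> between vertices in different components.
\<close>

definition graph_dist :: "('a, 'b) pre_digraph \<Rightarrow> 'a \<Rightarrow> 'a \<Rightarrow> ereal" where
  "graph_dist G u v = wf_digraph.\<mu> G (\<lambda>_. 1) u v"

definition transmission :: "('a, 'b) pre_digraph \<Rightarrow> 'a \<Rightarrow> ereal" where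
  "transmission G v = (\<Sum>u\<in>verts G. graph_dist G u v)"

definition transmission_irregular :: "('a, 'b) pre_digraph \<Rightarrow> bool" where
  "transmission_irregular G \<longleftrightarrow>
     (\<forall>u\<in>verts G. \<forall>v\<in>verts G. u \<noteq> v \<longrightarrow> transmission G u \<noteq> transmission G v)"

text \<open>
  The pendant paths of \<open>T(k\<^sub>1, \<dots>, k\<^sub>t)\<close> are indexed from 0, and \<open>Leg i j\<close> is the vertex of the
  \<open>i\<close>-th path at distance \<open>j \<ge> 1\<close> from the centre; so a path of length \<open>k\<close> contributes \<open>k\<close> vertices
  and \<open>k\<close> edges. Only lists of positive numbers of length at least 3 give starlike trees proper.
\<close>

datatype starlike_vertex = Centre | Leg nat nat

definition starlike_verts :: "nat list \<Rightarrow> starlike_vertex set" where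
  "starlike_verts ks = insert Centre {Leg i j | i j. i < length ks \<and> 1 \<le> j \<and> j \<le> ks ! i}"

definition starlike_outward_arcs :: "nat list \<Rightarrow> starlike_vertex rel" where
  "starlike_outward_arcs ks =
     {(Centre, Leg i 1) | i. i < length ks \<and> 1 \<le> ks ! i} \<union>
     {(Leg i j, Leg i (j + 1)) | i j. i < length ks \<and> 1 \<le> j \<and> j + 1 \<le> ks ! i}"

definition starlike_tree :: "nat list \<Rightarrow> starlike_vertex pair_pre_digraph" where
  "starlike_tree ks =
     \<lparr>pverts = starlike_verts ks,
      parcs = starlike_outward_arcs ks \<union> (starlike_outward_arcs ks)\<inverse>\<rparr>"

lemma finite_starlike_verts: "finite (starlike_verts ks)"
proof -
  have "starlike_verts ks \<subseteq>
    insert Centre ((\<lambda>(i, j). Leg i j) ` (SIGMA i:{..<length ks}. {..ks ! i}))"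
    by (auto simp: starlike_verts_def image_iff)
  then show ?thesis
    by (rule finite_subset) auto
qed

lemma pair_graph_starlike_tree: "pair_graph (starlike_tree ks)"
proof -
  let ?A = "starlike_outward_arcs ks \<union> (starlike_outward_arcs ks)\<inverse>"
  have sub: "?A \<subseteq> starlike_verts ks \<times> starlike_verts ks"
    by (auto simp: starlike_outward_arcs_def starlike_verts_def)
  have "finite ?A"
    using finite_subset[OF sub] finite_starlike_verts by blast
  moreover have "fst e \<noteq> snd e" if "e \<in> ?A" for e
    using that by (auto simp: starlike_outward_arcs_def)
  moreover have "sym ?A"
    by (auto simp: sym_def)
  moreover have "fst e \<in> starlike_verts ks" "snd e \<in> starlike_verts ks" if "e \<in> ?A" for e
    using subsetD[OF sub that] by auto
  ultimately show ?thesis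
    using finite_starlike_verts by unfold_locales (simp_all add: starlike_tree_def symmetric_def)
qed

lemma graph_starlike_tree: "graph (with_proj (starlike_tree ks))"
proof -
  interpret pair_graph "starlike_tree ks"
    by (rule pair_graph_starlike_tree)
  show ?thesis by unfold_locales (rule pair_sym_arcs)
qed

lemma connected_starlike_tree: "strongly_connected (with_proj (starlike_tree ks))"
proof -
  interpret T: pair_graph "starlike_tree ks"
    by (rule pair_graph_starlike_tree)
  let ?G = "with_proj (starlike_tree ks)"
  have leg: "Centre \<rightarrow>\<^sup>*\<^bsub>?G\<^esub> Leg i (Suc j)" if "i < length ks" "Suc j \<le> ks ! i" for i j
    using that(2)
  proof (induction j)
    case 0
    with that(1) have "(Centre, Leg i 1) \<in> parcs (starlike_tree ks)"
      by (auto simp: starlike_tree_def starlike_outward_arcs_def)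
    then show ?case by (intro T.reachable_adjI) simp
  next
    case (Suc j)
    with that(1) have "(Leg i (Suc j), Leg i (Suc (Suc j))) \<in> parcs (starlike_tree ks)"
      by (auto simp: starlike_tree_def starlike_outward_arcs_def)
    with Suc show ?case
      by (meson Suc_leD T.reachable_adj_trans with_proj_simps(3))
  qed
  have "Centre \<rightarrow>\<^sup>*\<^bsub>?G\<^esub> v" if "v \<in> verts ?G" for v
  proof (cases v)
    case Centre
    with that show ?thesis by simp
  next
    case (Leg i j)
    with that have "i < length ks" "1 \<le> j" "j \<le> ks ! i"
      by (auto simp: starlike_tree_def starlike_verts_def)
    with leg[of i "j - 1"] Leg show ?thesis by simp
  qed
  moreover from this have "v \<rightarrow>\<^sup>*\<^bsub>?G\<^esub> Centre" if "v \<in> verts ?G" for v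
    using that by (meson T.pair_sym_arcs symmetric_reachable)
  moreover have "Centre \<in> verts ?G"
    by (simp add: starlike_tree_def starlike_verts_def)
  ultimately show ?thesis
    unfolding strongly_connected_def by (blast intro: T.reachable_trans)
qed

definition last_leg :: "nat \<Rightarrow> nat \<Rightarrow> nat" where
  "last_leg a k = (\<Sum>j=0..k. a + j)"

lemma real_last_leg: "real (last_leg a k) = (real a + real k / 2) * (real k + 1)"
  unfolding last_leg_def by (induction k) (simp_all add: field_simps)

definition h_val :: "int \<Rightarrow> int \<Rightarrow> int" where
  "h_val a k = (k - 1) * (2 * a + k) + 2 * a - 1"

definition D_part :: "int \<Rightarrow> int \<Rightarrow> int \<Rightarrow> int set" where
  "D_part a k p =
     (if p \<le> a
      then {p * h_val a k + p * (p - 1) + 2 * p * i | i. i \<in> {1..k + 1}}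
      else {p * h_val a k + p * (p - 1) + 2 * p * i | i. i \<in> {1..(k + 1) - (p - a)}})"

definition D_set :: "int \<Rightarrow> int \<Rightarrow> int set" where
  "D_set a k = (\<Union>p\<in>{1..a + k}. D_part a k p)"

end

theory Submission
  imports Defs
begin

text \<open>
  In a starlike tree on \<open>n\<close> vertices, the vertex at depth \<open>j\<close> on a leg of length \<open>m\<close> has
  transmission \<open>j (n - 2 m + j - 1)\<close> more than the centre. Here \<open>n = 2 L + 1\<close>, where \<open>L\<close> is the length
  of the last leg; so on that leg the excess is \<open>j\<^sup>2\<close> (with \<open>j = 0\<close> for the centre), while on the other
  legs the excesses are exactly the elements of \<open>D\<close>. The bounds of the interval are harmless, being
  the minimum of \<open>D\<close> and the largest excess \<open>L\<^sup>2\<close> on the last leg. Finally, the excesses on the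
  short legs are pairwise distinct because every excess at depth \<open>p\<close> is smaller than
  every excess at a larger depth.
\<close>

section \<open>Distances and transmissions in starlike trees\<close>

context wf_digraph
begin

lemma awalk_cost_const_1: "awalk_cost (\<lambda>_. 1) p = real (length p)"
  by (induction p) simp_all

text \<open>Telescoping along the walk: each arc lowers \<open>d\<close> by at most 1.\<close>

lemma potential_le_length_awalk:
  fixes d :: "'a \<Rightarrow> nat"
  assumes "\<And>e. e \<in> arcs G \<Longrightarrow> d (tail G e) \<le> d (head G e) + 1"
    and "awalk u p v"
  shows "d u \<le> d v + length p"
  using assms(2)
proof (induction p arbitrary: u)
  case (Cons e p)
  then have "e \<in> arcs G" "u = tail G e" "d (head G e) \<le> d v + length p"
    by (auto simp: awalk_Cons_iff)
  with assms(1)[of e] show ?case by simp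
qed (simp add: awalk_Nil_iff)

text \<open>A certificate for distances: the Lipschitz condition bounds the length of every walk to
  \<open>v\<close> from below, and following descent arcs yields a walk of length exactly
  \<open>d u\<close>.\<close>

lemma graph_dist_eqI:
  fixes d :: "'a \<Rightarrow> nat"
  assumes lipschitz: "\<And>e. e \<in> arcs G \<Longrightarrow> d (tail G e) \<le> d (head G e) + 1"
    and descent: "\<And>x. x \<in> verts G \<Longrightarrow> x \<noteq> v \<Longrightarrow> \<exists>e\<in>arcs G. tail G e = x \<and> d x = d (head G e) + 1"
    and "d v = 0" and "u \<in> verts G"
  shows "graph_dist G u v = ereal (real (d u))"
proof -
  have "\<exists>p. awalk u p v \<and> length p = d u"
    using \<open>u \<in> verts G\<close>
  proof (induction "d u" arbitrary: u)
    case 0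
    \<comment> \<open>At any other vertex, descent would make \<open>d u\<close> a
      successor.\<close>
    then have "u = v"
      using descent by fastforce
    with 0 show ?case by (intro exI[of _ "[]"]) (simp add: awalk_Nil_iff)
  next
    case (Suc n)
    then have "u \<noteq> v"
      using \<open>d v = 0\<close> by auto
    then obtain e where e: "e \<in> arcs G" "tail G e = u" "d u = d (head G e) + 1"
      using descent Suc.prems by blast
    with Suc.hyps have "\<exists>p. awalk (head G e) p v \<and> length p = d (head G e)"
      by simp
    then obtain p where "awalk (head G e) p v" "length p = d (head G e)"
      by blast
    with e show ?case by (intro exI[of _ "e # p"]) (simp add: awalk_Cons_iff)
  qed
  then obtain p where p: "awalk u p v" "length p = d u"
    by blast
  have "\<mu> (\<lambda>_. 1) u v \<le> ereal (real (d u))"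
    using min_cost_le_walk_cost[OF p(1), of "\<lambda>_. 1"] p(2) by (simp add: awalk_cost_const_1)
  moreover have "ereal (real (d u)) \<le> \<mu> (\<lambda>_. 1) u v"
    unfolding \<mu>_def
  proof (rule INF_greatest)
    fix q assume "q \<in> {p. awalk u p v}"
    then have "d u \<le> length q"
      using potential_le_length_awalk[of d u q v] lipschitz \<open>d v = 0\<close> by simp
    then show "ereal (real (d u)) \<le> ereal (awalk_cost (\<lambda>_. 1) q)"
      by (simp add: awalk_cost_const_1)
  qed
  ultimately show ?thesis
    unfolding graph_dist_def by (rule antisym)
qed

end

text \<open>On a common leg, \<open>j - j' + (j' - j)\<close> is the absolute difference, as subtraction truncates.\<close>

fun starlike_dist :: "starlike_vertex \<Rightarrow> starlike_vertex \<Rightarrow> nat" where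
  "starlike_dist Centre Centre = 0"
| "starlike_dist Centre (Leg i j) = j"
| "starlike_dist (Leg i j) Centre = j"
| "starlike_dist (Leg i j) (Leg i' j') = (if i = i' then j - j' + (j' - j) else j + j')"

text \<open>The closed form meets the conditions of \<open>graph_dist_eqI\<close>; the descending
  neighbour is the next vertex on the path towards \<open>v\<close>.\<close>

lemma graph_dist_starlike_tree:
  assumes u: "u \<in> starlike_verts ks" and v: "v \<in> starlike_verts ks"
  shows "graph_dist (with_proj (starlike_tree ks)) u v = ereal (real (starlike_dist u v))"
proof -
  interpret pair_graph "starlike_tree ks"
    by (rule pair_graph_starlike_tree)
  have descent: "\<exists>x. (u, x) \<in> parcs (starlike_tree ks) \<and> starlike_dist u v = starlike_dist x v + 1"
    if u: "u \<in> starlike_verts ks" and "u \<noteq> v" for u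
  proof (cases u)
    case Centre
    with \<open>u \<noteq> v\<close> obtain i j where ij: "v = Leg i j"
      by (cases v) auto
    with v Centre show ?thesis
      by (intro exI[of _ "Leg i 1"])
        (auto simp: starlike_tree_def starlike_outward_arcs_def starlike_verts_def)
  next
    case (Leg i j)
    with u have ij: "i < length ks" "1 \<le> j" "j \<le> ks ! i"
      by (auto simp: starlike_verts_def)
    show ?thesis
    \<comment> \<open>The path leads outward only if \<open>v\<close> lies deeper on the same
      leg.\<close>
    proof (cases "\<exists>j'>j. v = Leg i j'")
      case True
      with v Leg ij show ?thesis
        by (intro exI[of _ "Leg i (j + 1)"])
          (auto simp: starlike_tree_def starlike_outward_arcs_def starlike_verts_def)
    next
      case False
      show ?thesis
      \<comment> \<open>The inward neighbour at depth 1 is \<open>Centre\<close>, since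
        \<open>Leg i 0\<close> is not a vertex.\<close>
      proof (cases "j = 1")
        case True
        with False v Leg ij \<open>u \<noteq> v\<close> show ?thesis
          by (intro exI[of _ Centre], cases v)
            (auto simp: starlike_tree_def starlike_outward_arcs_def starlike_verts_def)
      next
        case j: False
        have "(Leg i j, Leg i (j - 1)) \<in> parcs (starlike_tree ks)"
          using ij j
          by (auto simp: starlike_tree_def starlike_outward_arcs_def intro!: exI[of _ "j - 1"])
        moreover have "starlike_dist u v = starlike_dist (Leg i (j - 1)) v + 1"
          using False Leg ij j \<open>u \<noteq> v\<close> by (cases v) (auto simp: not_less)
        ultimately show ?thesis
          using Leg by blast
      qed
    qed
  qed
  show ?thesis
  proof (rule graph_dist_eqI[where d = "\<lambda>u. starlike_dist u v"])
    fix e assume "e \<in> parcs (starlike_tree ks)"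
    then show "starlike_dist (fst e) v \<le> starlike_dist (snd e) v + 1"
      by (cases v) (auto simp: starlike_tree_def starlike_outward_arcs_def)
  next
    fix x assume "x \<in> pverts (starlike_tree ks)" "x \<noteq> v"
    then show "\<exists>e\<in>parcs (starlike_tree ks). fst e = x \<and> starlike_dist x v = starlike_dist (snd e) v + 1"
      using descent[of x] by (force simp: starlike_tree_def)
  next
    show "starlike_dist v v = 0" by (cases v) auto
  next
    show "u \<in> pverts (starlike_tree ks)"
      using u by (simp add: starlike_tree_def)
  qed
qed

lemma sum_starlike_verts:
  "(\<Sum>u\<in>starlike_verts ks. f u) = f Centre + (\<Sum>i<length ks. \<Sum>j=1..ks ! i. f (Leg i j))"
proof -
  let ?S = "SIGMA i:{..<length ks}. {1..ks ! i}"
  have eq: "starlike_verts ks = insert Centre ((\<lambda>(i, j). Leg i j) ` ?S)"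
    by (auto simp: starlike_verts_def image_iff)
  have "inj_on (\<lambda>(i, j). Leg i j) ?S"
    by (auto simp: inj_on_def)
  then have "(\<Sum>u\<in>(\<lambda>(i, j). Leg i j) ` ?S. f u) = (\<Sum>i<length ks. \<Sum>j=1..ks ! i. f (Leg i j))"
    by (simp add: sum.reindex sum.Sigma case_prod_unfold)
  moreover have "Centre \<notin> (\<lambda>(i, j). Leg i j) ` ?S" by auto
  ultimately show ?thesis
    unfolding eq by (subst sum.insert) auto
qed

definition starlike_trans :: "nat list \<Rightarrow> starlike_vertex \<Rightarrow> nat" where
  "starlike_trans ks v = (\<Sum>u\<in>starlike_verts ks. starlike_dist u v)"

lemma transmission_starlike_tree:
  assumes "v \<in> starlike_verts ks"
  shows "transmission (with_proj (starlike_tree ks)) v = ereal (real (starlike_trans ks v))"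
proof -
  have "transmission (with_proj (starlike_tree ks)) v
      = (\<Sum>u\<in>starlike_verts ks. graph_dist (with_proj (starlike_tree ks)) u v)"
    by (simp add: transmission_def starlike_tree_def)
  also have "\<dots> = (\<Sum>u\<in>starlike_verts ks. ereal (real (starlike_dist u v)))"
    using assms by (intro sum.cong refl graph_dist_starlike_tree)
  finally show ?thesis
    by (simp add: starlike_trans_def)
qed

text \<open>Induction from \<open>m = j\<close>: each further vertex lies beyond
  \<open>Leg i j\<close>, at a distance \<open>j\<close> less than its depth, so both sides grow
  alike.\<close>

lemma sum_starlike_dist_same_leg:
  assumes "j \<le> m"
  shows "(\<Sum>j'=1..m. int (starlike_dist (Leg i j') (Leg i j)))
    = (\<Sum>j'=1..m. int j') + int j * (int j - 1 - int m)"
  using assms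
proof (induction m rule: dec_induct)
  case base
  have "(\<Sum>j'=1..j. int (starlike_dist (Leg i j') (Leg i j))) = (\<Sum>j'=1..j. int j - int j')"
    by (intro sum.cong) auto
  moreover have "2 * (\<Sum>j'=1..j. int j') = int j * (int j + 1)"
    by (induction j) (simp_all add: algebra_simps)
  ultimately show ?case
    by (simp add: sum_subtractf algebra_simps)
next
  case (step m)
  then show ?case by (simp add: algebra_simps)
qed

text \<open>Compared with the centre, each vertex off leg \<open>i\<close> adds \<open>j\<close>,
  the centre included; the leg itself is covered by
  \<open>sum_starlike_dist_same_leg\<close>.\<close>

lemma starlike_trans_Leg:
  assumes i: "i < length ks" and "j \<le> ks ! i"
  shows "int (starlike_trans ks (Leg i j))
    = int (starlike_trans ks Centre)
      + int j * (int (sum_list ks) + 1 - 2 * int (ks ! i) + int j - 1)"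
proof -
  define C where "C i' = (\<Sum>j'=1..ks ! i'. int j')" for i'
  have leg: "(\<Sum>j'=1..ks ! i'. int (starlike_dist (Leg i' j') (Leg i j)))
      = C i' + int j * int (ks ! i') + (if i' = i then int j * (int j - 1 - 2 * int (ks ! i)) else 0)"
    for i'
  proof (cases "i' = i")
    case True
    then show ?thesis
      using sum_starlike_dist_same_leg[OF assms(2), of i] unfolding C_def
      by (simp add: algebra_simps)
  next
    case False
    then show ?thesis
      by (simp add: C_def sum.distrib)
  qed
  have "int (starlike_trans ks (Leg i j))
      = int j + (\<Sum>i'<length ks. \<Sum>j'=1..ks ! i'. int (starlike_dist (Leg i' j') (Leg i j)))"
    by (simp add: starlike_trans_def sum_starlike_verts)
  also have "\<dots> = int j + (\<Sum>i'<length ks. C i') + int j * (\<Sum>i'<length ks. int (ks ! i'))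
      + int j * (int j - 1 - 2 * int (ks ! i))"
    using i unfolding leg by (simp add: sum.distrib sum_distrib_left)
  also have "(\<Sum>i'<length ks. int (ks ! i')) = int (sum_list ks)"
    by (simp add: sum_list_sum_nth atLeast0LessThan)
  also have "(\<Sum>i'<length ks. C i') = int (starlike_trans ks Centre)"
    by (simp add: starlike_trans_def sum_starlike_verts C_def)
  finally show ?thesis
    by (simp add: algebra_simps)
qed

section \<open>Excesses on the short legs\<close>

text \<open>The term \<open>(k + 1) (2 a + k) + 1\<close> is the number \<open>n\<close> of vertices of the tree.\<close>

definition excess :: "int \<Rightarrow> int \<Rightarrow> int \<Rightarrow> int \<Rightarrow> int" where
  "excess a k m p = p * ((k + 1) * (2 * a + k) + 1 - 2 * m + p - 1)"

text \<open>At a fixed depth the excess decreases in the leg length. Hence the critical comparison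
  is between the largest value at depth \<open>p\<close>, for length \<open>max a p\<close>, and the
  smallest at depth \<open>p + 1\<close>, for length \<open>a + k\<close>.\<close>

lemma excess_less_excess:
  assumes "a > 0" "k > 0" "1 \<le> p" "p < q" "a \<le> m" "p \<le> m" "m' \<le> a + k" "q \<le> m'"
  shows "excess a k m p < excess a k m' q"
proof -
  define n where "n = (k + 1) * (2 * a + k) + 1"
  have n: "n \<ge> 2 * (a + k) + 1 - k + k * k"
    using assms by (simp add: n_def algebra_simps)
  have "excess a k m p \<le> p * (n - 2 * max a p + p - 1)"
    using assms unfolding excess_def n_def[symmetric] by (intro mult_left_mono) auto
  also have "\<dots> < (p + 1) * (n - 2 * (a + k) + p)"
  proof (cases "p \<le> a")
    case True
    have "(p + 1) * (n - 2 * (a + k) + p) - p * (n - 2 * max a p + p - 1)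
        = (a - p) * (2 * k - 2) + 2 * a + k * (k - 1) + 1"
      using True by (simp add: n_def algebra_simps)
    moreover have "(a - p) * (2 * k - 2) \<ge> 0" "k * (k - 1) \<ge> 0"
      using assms True by auto
    ultimately show ?thesis using assms by linarith
  next
    case False
    \<comment> \<open>Here \<open>r < k\<close> comes from \<open>p < q\<close> and
      \<open>q \<le> a + k\<close>; it keeps the last product below nonnegative.\<close>
    define r where "r = p - a"
    have r: "0 < r" "r < k" "p = a + r"
      using False assms by (auto simp: r_def)
    have "(p + 1) * (n - 2 * (a + k) + p) - p * (n - 2 * max a p + p - 1)
        = 2 * a * (1 + r) + r * r + (k - r) * (k - r - 1) + r + 1"
      using r by (simp add: n_def algebra_simps)
    moreover have "2 * a * (1 + r) \<ge> 0" "r * r \<ge> 0" "(k - r) * (k - r - 1) \<ge> 0"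
      using assms r by auto
    ultimately show ?thesis using r by linarith
  qed
  also have "\<dots> \<le> q * (n - 2 * m' + q - 1)"
  proof (intro mult_mono)
    show "0 \<le> n - 2 * (a + k) + p"
    proof -
      have "k * k \<ge> k" using assms by simp
      then show ?thesis using n assms by linarith
    qed
  qed (use assms in auto)
  finally show ?thesis
    by (simp add: excess_def n_def)
qed

text \<open>Equal excesses force equal depths, and at a fixed positive depth the excess is strictly
  decreasing in \<open>m\<close>.\<close>

lemma excess_inject:
  assumes "a > 0" "k > 0" "1 \<le> p" "1 \<le> q"
    and "a \<le> m" "p \<le> m" "m \<le> a + k" "a \<le> m'" "q \<le> m'" "m' \<le> a + k"
    and eq: "excess a k m p = excess a k m' q"
  shows "m = m' \<and> p = q"
proof -
  have "\<not> p < q" "\<not> q < p"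
    using excess_less_excess[of a k p q m m'] excess_less_excess[of a k q p m' m] assms by auto
  then have "p = q" by simp
  with eq \<open>1 \<le> p\<close> show ?thesis by (simp add: excess_def)
qed

text \<open>The bound, which is the left end of the interval, is the excess at depth 1 for the
  greatest length \<open>a + k\<close>.\<close>

lemma excess_ge:
  assumes "a > 0" "k > 0" "1 \<le> p" "a \<le> m" "p \<le> m" "m \<le> a + k"
  shows "k * (2 * a + k - 1) + 1 \<le> excess a k m p"
proof -
  have "k * (2 * a + k - 1) + 1 = excess a k (a + k) 1"
    by (simp add: excess_def algebra_simps)
  also have "\<dots> \<le> excess a k m p"
  proof (cases "p = 1")
    case True
    with assms show ?thesis by (simp add: excess_def)
  next
    case False
    then have "excess a k (a + k) 1 < excess a k m p"
      using assms by (intro excess_less_excess) auto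
    then show ?thesis by simp
  qed
  finally show ?thesis .
qed

text \<open>The leg of length \<open>m\<close> corresponds to the index \<open>i = a + k + 1 - m\<close> in the definition of \<open>D\<^sub>p\<close>.\<close>

lemma excess_in_D_set:
  assumes "1 \<le> p" "a \<le> m" "p \<le> m" "m \<le> a + k"
  shows "excess a k m p \<in> D_set a k"
proof -
  have "excess a k m p = p * h_val a k + p * (p - 1) + 2 * p * (a + k + 1 - m)"
    by (simp add: excess_def h_val_def algebra_simps)
  then have "excess a k m p \<in> D_part a k p"
    using assms by (auto simp: D_part_def)
  with assms show ?thesis
    by (auto simp: D_set_def)
qed

section \<open>The transmission irregular starlike trees\<close>

lemma double_last_leg: "2 * last_leg a k = (k + 1) * (2 * a + k)"
  unfolding last_leg_def by (induction k) (simp_all add: algebra_simps)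

theorem theorem3p3:
  fixes a k :: nat
  assumes "a > 0" and "k > 0"
    and "\<not> (\<exists>d\<in>D_set (int a) (int k). is_square d \<and>
           real_of_int d \<in> {real k * (2 * real a + real k - 1) + 1 ..
                             (real a + real k / 2)^2 * (real k + 1)^2})"
  shows "transmission_irregular (with_proj (starlike_tree ([a..<a + k + 1] @ [last_leg a k])))"
proof -
  define L where "L = last_leg a k"
  define ks where "ks = [a..<a + k + 1] @ [L]"
  define c where "c = int (starlike_trans ks Centre)"
  have length_ks: "length ks = k + 2"
    by (simp add: ks_def)
  have short: "ks ! i = a + i" if "i \<le> k" for i
    using that by (simp add: ks_def nth_append del: upt_Suc)
  have long: "ks ! (k + 1) = L"
    by (simp add: ks_def nth_append del: upt_Suc)
  \<comment> \<open>The short legs together are as long as the last leg, so the tree has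
    \<open>2 * L + 1\<close> vertices.\<close>
  have "sum_list [a..<a + k + 1] = L"
    unfolding L_def last_leg_def by (induction k) simp_all
  then have sum_ks: "sum_list ks = 2 * L"
    by (simp add: ks_def)
  have twoL: "2 * int L = (int k + 1) * (2 * int a + int k)"
    using arg_cong[OF double_last_leg[of a k], of int] by (simp add: L_def algebra_simps)
  have trans_short: "int (starlike_trans ks (Leg i j)) = c + excess (int a) (int k) (int (a + i)) (int j)"
    if "i \<le> k" "j \<le> a + i" for i j
    using starlike_trans_Leg[of i ks j] that short[of i] sum_ks twoL
    by (simp add: length_ks c_def excess_def)
  \<comment> \<open>Since \<open>sum_list ks + 1 - 2 * L = 1\<close>, the second factor of the
    excess collapses to \<open>j\<close>.\<close>
  have trans_long: "int (starlike_trans ks (Leg (k + 1) j)) = c + (int j)\<^sup>2" if "j \<le> L" for j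
    using starlike_trans_Leg[of "k + 1" ks j] that long sum_ks
    by (simp add: length_ks c_def power2_eq_square)
  \<comment> \<open>Equality would put a square of \<open>D_set\<close> into the excluded interval,
    whose right end is the square of \<open>L\<close>. The value \<open>j' = 0\<close> stands for
    the centre.\<close>
  have not_square: "excess (int a) (int k) (int (a + i)) (int j) \<noteq> (int j')\<^sup>2"
    if "i \<le> k" "1 \<le> j" "j \<le> a + i" "j' \<le> L" for i j j'
  proof
    let ?d = "excess (int a) (int k) (int (a + i)) (int j)"
    assume eq: "?d = (int j')\<^sup>2"
    have "?d \<in> D_set (int a) (int k)"
      using that by (intro excess_in_D_set) auto
    moreover have "is_square ?d"
      unfolding eq by simp
    moreover have "real k * (2 * real a + real k - 1) + 1 \<le> real_of_int ?d"
    proof -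
      have "int k * (2 * int a + int k - 1) + 1 \<le> ?d"
        using that assms by (intro excess_ge) auto
      then have "real_of_int (int k * (2 * int a + int k - 1) + 1) \<le> real_of_int ?d"
        by (simp only: of_int_le_iff)
      then show ?thesis by simp
    qed
    moreover have "real_of_int ?d \<le> (real a + real k / 2)^2 * (real k + 1)^2"
    proof -
      have "real_of_int ?d \<le> (real L)\<^sup>2"
        unfolding eq using that(4) by (simp add: power_mono)
      then show ?thesis
        by (simp add: L_def real_last_leg power_mult_distrib)
    qed
    ultimately show False
      using assms(3) by auto
  qed
  \<comment> \<open>The centre is treated as depth 0 of the last leg, its excess 0 being a square
    too.\<close>
  have cases: "(\<exists>j\<le>L. v = (if j = 0 then Centre else Leg (k + 1) j) \<and> int (starlike_trans ks v) = c + (int j)\<^sup>2)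
      \<or> (\<exists>i\<le>k. \<exists>j\<ge>1. j \<le> a + i \<and> v = Leg i j
           \<and> int (starlike_trans ks v) = c + excess (int a) (int k) (int (a + i)) (int j))"
    if v: "v \<in> starlike_verts ks" for v
  proof (cases v)
    case Centre
    then show ?thesis by (auto simp: c_def)
  next
    case (Leg i j)
    with v have ij: "i < k + 2" "1 \<le> j" "j \<le> ks ! i"
      by (auto simp: starlike_verts_def length_ks)
    show ?thesis
    proof (cases "i \<le> k")
      case True
      with ij Leg trans_short[of i j] short[of i] show ?thesis by auto
    next
      case False
      with ij have "i = k + 1" by simp
      with ij Leg trans_long[of j] long show ?thesis by auto
    qed
  qed
  have "u = v" if u: "u \<in> starlike_verts ks" and v: "v \<in> starlike_verts ks"
    and eq: "starlike_trans ks u = starlike_trans ks v" for u v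
    using cases[OF u]
  proof (elim disjE exE conjE)
    fix j assume j: "j \<le> L" "u = (if j = 0 then Centre else Leg (k + 1) j)"
      "int (starlike_trans ks u) = c + (int j)\<^sup>2"
    from cases[OF v] show ?thesis
    proof (elim disjE exE conjE)
      fix j' assume "j' \<le> L" "v = (if j' = 0 then Centre else Leg (k + 1) j')"
        "int (starlike_trans ks v) = c + (int j')\<^sup>2"
      with j eq show ?thesis by simp
    next
      fix i' j' assume "i' \<le> k" "1 \<le> j'" "j' \<le> a + i'"
        "int (starlike_trans ks v) = c + excess (int a) (int k) (int (a + i')) (int j')"
      with j eq not_square[of i' j' j] show ?thesis by simp
    qed
  next
    fix i j assume ij: "i \<le> k" "1 \<le> j" "j \<le> a + i" "u = Leg i j"
      "int (starlike_trans ks u) = c + excess (int a) (int k) (int (a + i)) (int j)"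
    from cases[OF v] show ?thesis
    proof (elim disjE exE conjE)
      fix j' assume "j' \<le> L" "int (starlike_trans ks v) = c + (int j')\<^sup>2"
      with ij eq not_square[of i j j'] show ?thesis by simp
    next
      fix i' j' assume ij': "i' \<le> k" "1 \<le> j'" "j' \<le> a + i'" "v = Leg i' j'"
        "int (starlike_trans ks v) = c + excess (int a) (int k) (int (a + i')) (int j')"
      \<comment> \<open>The length \<open>a + i\<close> determines the short leg, so equal lengths
        give equal indices.\<close>
      have "int (a + i) = int (a + i') \<and> int j = int j'"
        using ij ij' eq assms(1,2) by (intro excess_inject[of "int a" "int k"]) auto
      with ij ij' show ?thesis by simp
    qed
  qed
  then show ?thesis
    unfolding transmission_irregular_def L_def[symmetric] ks_def[symmetric]
    by (auto simp: transmission_starlike_tree starlike_tree_def[THEN arg_cong[where f = pverts]])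
qed

end
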